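(* Let $J^3$ be the space of $3$-jets with coordinates $(x,y,u,u_x,u_y,u_{xx},u_{xy},u_{yy},u_{xxx},u_{xxy},u_{xyy},u_{yyy})$. The subset $$\mathcal{E}=\{\,(u_{xx}u_{yy}-u_{xy}^2)\cdot F=0\,\}\subset J^3,$$ where $$\begin{aligned}F={}&6 u_{xx} u_{xxx} u_{xy} u_{yy}u_{yyy}-6 u_{xx} u_{xxx} u_{xyy}u_{yy}^2-18 u_{xx} u_{xxy} u_{xy}u_{xyy} u_{yy}+12 u_{xx} u_{xxy}u_{xy}^2 u_{yyy}\\&-6 u_{xx}^2 u_{xxy}u_{yy} u_{yyy}+9 u_{xx} u_{xxy}^2u_{yy}^2-6 u_{xx}^2 u_{xy} u_{xyy}u_{yyy}+9 u_{xx}^2 u_{xyy}^2u_{yy}+u_{xx}^3 u_{yyy}^2-6 u_{xxx}u_{xxy} u_{xy} u_{yy}^2\\&+12 u_{xxx}u_{xy}^2 u_{xyy} u_{yy}-8 u_{xxx}u_{xy}^3 u_{yyy}+u_{xxx}^2 u_{yy}^3,\end{aligned}$$ is $\mathrm{Aff}(3)$-invariant.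
   Context: $\mathrm{Aff}(3)$ is the group of affine transformations of $\mathbb{R}^3=\{(x,y,u)\}$. For a surface $S\subset\mathbb{R}^3$ and $p\in S$, $[S]^\ell_p$ is the $\ell$-jet of $S$ at $p$ (the class of surfaces having contact of order $\ell$ with $S$ at $p$), and $J^\ell$ is the space of $\ell$-jets of surfaces of $\mathbb{R}^3$. In the chart of jets of graphs $S=\{u=f(x,y)\}$, the coordinates $x,y,u,u_x,u_y,u_{xx},\dots$ of $[S]^\ell_p$ are the coordinates of $p$ and the partial derivatives of $f$ at $p$. A local diffeomorphism $\phi$ of $\mathbb{R}^3$ acts on jets by $\phi\cdot[S]^\ell_p=[\phi(S)]^\ell_{\phi(p)}$. A subset of $J^\ell$ is $\mathrm{Aff}(3)$-invariant if it is preserved by this action of $\mathrm{Aff}(3)$ (wherever the image jet lies in the coordinate chart). *)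

theory Defs
  imports "HOL-Analysis.Analysis"
begin

definition Aff3 :: "(real^3 \<Rightarrow> real^3) set" where
  "Aff3 = {\<phi>. \<exists>(A::real^3^3) b. invertible A \<and> \<phi> = (\<lambda>p. A *v p + b)}"


section \<open>Smooth functions of two real variables\<close>

definition dx :: "(real \<times> real \<Rightarrow> real) \<Rightarrow> real \<times> real \<Rightarrow> real" where
  "dx f = (\<lambda>(x, y). deriv (\<lambda>t. f (t, y)) x)"

definition dy :: "(real \<times> real \<Rightarrow> real) \<Rightarrow> real \<times> real \<Rightarrow> real" where
  "dy f = (\<lambda>(x, y). deriv (\<lambda>t. f (x, t)) y)"

definition partial :: "nat \<Rightarrow> nat \<Rightarrow> (real \<times> real \<Rightarrow> real) \<Rightarrow> real \<times> real \<Rightarrow> real" where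
  "partial i j f = (dx ^^ i) ((dy ^^ j) f)"

primrec Ck_on :: "nat \<Rightarrow> (real \<times> real) set \<Rightarrow> (real \<times> real \<Rightarrow> real) \<Rightarrow> bool" where
  "Ck_on 0 D f \<longleftrightarrow> continuous_on D f"
| "Ck_on (Suc k) D f \<longleftrightarrow> f differentiable_on D \<and> Ck_on k D (dx f) \<and> Ck_on k D (dy f)"

definition smooth_on :: "(real \<times> real) set \<Rightarrow> (real \<times> real \<Rightarrow> real) \<Rightarrow> bool" where
  "smooth_on D f \<longleftrightarrow> (\<forall>k. Ck_on k D f)"


section \<open>Surfaces, contact and jets\<close>

abbreviation xy :: "real^3 \<Rightarrow> real \<times> real" where
  "xy p \<equiv> (p $ 1, p $ 2)"

text \<open>Near its point \<open>p\<close>, the set \<open>S\<close> is the graph \<open>u = f (x, y)\<close> of a smooth function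
  defined on a neighbourhood \<open>D\<close> of the projection of \<open>p\<close>.\<close>

definition graph_near :: "(real^3) set \<Rightarrow> real^3 \<Rightarrow> (real \<times> real \<Rightarrow> real) \<Rightarrow> bool" where
  "graph_near S p f \<longleftrightarrow> p \<in> S \<and>
     (\<exists>D W. open D \<and> xy p \<in> D \<and> smooth_on D f \<and> open W \<and> p \<in> W \<and>
        S \<inter> W = {q. xy q \<in> D \<and> q $ 3 = f (xy q)} \<inter> W)"

text \<open>A smooth (embedded) surface is a set which near each of its points is a smooth graph in
  suitable affine coordinates; it need not be a graph in the coordinates \<open>(x, y, u)\<close> themselves.\<close>

definition smooth_surface :: "(real^3) set \<Rightarrow> bool" where
  "smooth_surface S \<longleftrightarrow> (\<forall>p\<in>S. \<exists>\<psi>\<in>Aff3. \<exists>f. graph_near (\<psi> ` S) (\<psi> p) f)"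

text \<open>Contact of order \<open>l\<close> at \<open>p\<close>: in affine coordinates in which both surfaces are graphs
  near \<open>p\<close>, the two functions have the same Taylor polynomial of order \<open>l\<close>. By the chain rule and
  the implicit function theorem, the choice of such coordinates is immaterial.\<close>

definition contact :: "nat \<Rightarrow> real^3 \<Rightarrow> (real^3) set \<Rightarrow> (real^3) set \<Rightarrow> bool" where
  "contact l p S T \<longleftrightarrow> (\<exists>\<psi>\<in>Aff3. \<exists>f g.
     graph_near (\<psi> ` S) (\<psi> p) f \<and> graph_near (\<psi> ` T) (\<psi> p) g \<and>
     (\<forall>i j. i + j \<le> l \<longrightarrow> partial i j f (xy (\<psi> p)) = partial i j g (xy (\<psi> p))))"

text \<open>A jet is the class of surfaces having contact with a given one, tagged with its base point.\<close>

type_synonym surface_jet = "(real^3) \<times> (real^3) set set"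

definition jet :: "nat \<Rightarrow> (real^3) set \<Rightarrow> real^3 \<Rightarrow> surface_jet" where
  "jet l S p = (p, {T. smooth_surface T \<and> contact l p S T})"

definition jet_space :: "nat \<Rightarrow> surface_jet set" where
  "jet_space l = {jet l S p | S p. smooth_surface S \<and> p \<in> S}"

text \<open>\<open>has_jet_coords l J u\<close>: the jet \<open>J\<close> lies in the chart of jets of graphs and
  \<open>u i j\<close>, for \<open>i + j \<le> l\<close>, is its coordinate given by \<open>i\<close> derivatives in \<open>x\<close> and \<open>j\<close> in \<open>y\<close>
  (the coordinates \<open>x, y\<close> are the first two components of the base point \<open>fst J\<close>).\<close>

definition has_jet_coords :: "nat \<Rightarrow> surface_jet \<Rightarrow> (nat \<Rightarrow> nat \<Rightarrow> real) \<Rightarrow> bool" where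
  "has_jet_coords l J u \<longleftrightarrow> (\<exists>S p f. smooth_surface S \<and> graph_near S p f \<and> J = jet l S p \<and>
     (\<forall>i j. i + j \<le> l \<longrightarrow> u i j = partial i j f (xy p)))"

definition graph_chart :: "nat \<Rightarrow> surface_jet set" where
  "graph_chart l = {J. \<exists>u. has_jet_coords l J u}"


section \<open>The action on jets\<close>

definition jet_action :: "(real^3 \<Rightarrow> real^3) \<Rightarrow> surface_jet \<Rightarrow> surface_jet" where
  "jet_action \<phi> J = (\<phi> (fst J), image \<phi> ` snd J)"

definition aff_invariant :: "nat \<Rightarrow> surface_jet set \<Rightarrow> bool" where
  "aff_invariant l E \<longleftrightarrow> E \<subseteq> jet_space l \<and>
     (\<forall>\<phi>\<in>Aff3. \<forall>J\<in>E. jet_action \<phi> J \<in> graph_chart l \<longrightarrow> jet_action \<phi> J \<in> E)"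

text \<open>The following facts show that the action on jets is the one induced by moving surfaces:
  \<open>\<phi>\<close> sends the jet of \<open>S\<close> at \<open>p\<close> to the jet of \<open>\<phi>(S)\<close> at \<open>\<phi>(p)\<close>.\<close>

lemma Aff3_comp:
  assumes "\<phi> \<in> Aff3" "\<psi> \<in> Aff3"
  shows "\<phi> \<circ> \<psi> \<in> Aff3"
proof -
  obtain A :: "real^3^3" and b where A: "invertible A" "\<phi> = (\<lambda>p. A *v p + b)"
    using assms(1) by (auto simp: Aff3_def)
  obtain B :: "real^3^3" and c where B: "invertible B" "\<psi> = (\<lambda>p. B *v p + c)"
    using assms(2) by (auto simp: Aff3_def)
  have "\<phi> \<circ> \<psi> = (\<lambda>p. (A ** B) *v p + (A *v c + b))"
    by (auto simp: A B matrix_vector_right_distrib matrix_vector_mul_assoc)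
  moreover have "invertible (A ** B)"
    using A B by (simp add: invertible_mult)
  ultimately show ?thesis
    unfolding Aff3_def by blast
qed

lemma Aff3_inverse:
  assumes "\<phi> \<in> Aff3"
  obtains \<phi>' where "\<phi>' \<in> Aff3" "\<And>p. \<phi>' (\<phi> p) = p" "\<And>p. \<phi> (\<phi>' p) = p"
proof -
  obtain A :: "real^3^3" and b where A: "invertible A" "\<phi> = (\<lambda>p. A *v p + b)"
    using assms by (auto simp: Aff3_def)
  then obtain B where B: "A ** B = mat 1" "B ** A = mat 1"
    by (auto simp: invertible_def)
  define \<phi>' where "\<phi>' = (\<lambda>p. B *v (p - b))"
  have "invertible B"
    using B by (auto simp: invertible_def)
  moreover have "\<phi>' = (\<lambda>p. B *v p + - (B *v b))"
    by (simp add: \<phi>'_def matrix_vector_mult_diff_distrib)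
  ultimately have "\<phi>' \<in> Aff3"
    unfolding Aff3_def by blast
  moreover have "\<phi>' (\<phi> p) = p" for p
    by (simp add: \<phi>'_def A matrix_vector_mul_assoc B)
  moreover have "\<phi> (\<phi>' p) = p" for p
    by (simp add: \<phi>'_def A matrix_vector_mul_assoc B)
  ultimately show ?thesis
    using that by blast
qed

lemma smooth_surface_image:
  assumes "\<phi> \<in> Aff3" "smooth_surface S"
  shows "smooth_surface (\<phi> ` S)"
  unfolding smooth_surface_def
proof
  fix q assume "q \<in> \<phi> ` S"
  then obtain p where p: "p \<in> S" "q = \<phi> p" by blast
  obtain \<phi>' where \<phi>': "\<phi>' \<in> Aff3" "\<And>p. \<phi>' (\<phi> p) = p"
    using Aff3_inverse[OF assms(1)] by metis
  obtain \<psi> f where \<psi>: "\<psi> \<in> Aff3" "graph_near (\<psi> ` S) (\<psi> p) f"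
    using assms(2) p by (auto simp: smooth_surface_def)
  have "graph_near ((\<psi> \<circ> \<phi>') ` \<phi> ` S) ((\<psi> \<circ> \<phi>') q) f"
    using \<psi> \<phi>' p by (simp add: image_image)
  then show "\<exists>\<psi>\<in>Aff3. \<exists>f. graph_near (\<psi> ` \<phi> ` S) (\<psi> q) f"
    using Aff3_comp[OF \<psi>(1) \<phi>'(1)] by blast
qed

lemma contact_image:
  assumes "\<phi> \<in> Aff3" "contact l p S T"
  shows "contact l (\<phi> p) (\<phi> ` S) (\<phi> ` T)"
proof -
  obtain \<phi>' where \<phi>': "\<phi>' \<in> Aff3" "\<And>p. \<phi>' (\<phi> p) = p"
    using Aff3_inverse[OF assms(1)] by metis
  obtain \<psi> f g where \<psi>: "\<psi> \<in> Aff3" "graph_near (\<psi> ` S) (\<psi> p) f" "graph_near (\<psi> ` T) (\<psi> p) g"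
    "\<forall>i j. i + j \<le> l \<longrightarrow> partial i j f (xy (\<psi> p)) = partial i j g (xy (\<psi> p))"
    using assms(2) by (auto simp: contact_def)
  show ?thesis
    unfolding contact_def
    by (rule bexI[of _ "\<psi> \<circ> \<phi>'"], rule exI[of _ f], rule exI[of _ g])
      (use \<psi> \<phi>' Aff3_comp[OF \<psi>(1) \<phi>'(1)] in \<open>simp_all add: image_image\<close>)
qed

lemma jet_action_jet:
  assumes "\<phi> \<in> Aff3"
  shows "jet_action \<phi> (jet l S p) = jet l (\<phi> ` S) (\<phi> p)"
proof -
  obtain \<phi>' where \<phi>': "\<phi>' \<in> Aff3" "\<And>p. \<phi>' (\<phi> p) = p" "\<And>p. \<phi> (\<phi>' p) = p"
    using Aff3_inverse[OF assms] by metis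
  have "T \<in> image \<phi> ` {T. smooth_surface T \<and> contact l p S T}"
    if T: "smooth_surface T" "contact l (\<phi> p) (\<phi> ` S) T" for T
  proof
    show "T = \<phi> ` \<phi>' ` T"
      by (simp add: image_image \<phi>')
    have "contact l p S (\<phi>' ` T)"
      using contact_image[OF \<phi>'(1) T(2)] by (simp add: image_image \<phi>')
    then show "\<phi>' ` T \<in> {T. smooth_surface T \<and> contact l p S T}"
      using smooth_surface_image[OF \<phi>'(1) T(1)] by simp
  qed
  then show ?thesis
    using assms by (auto simp: jet_action_def jet_def smooth_surface_image contact_image)
qed


section \<open>The subset of the space of 3-jets\<close>

definition F ::
  "real \<Rightarrow> real \<Rightarrow> real \<Rightarrow> real \<Rightarrow> real \<Rightarrow> real \<Rightarrow> real \<Rightarrow> real" where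
  "F uxx uxy uyy uxxx uxxy uxyy uyyy =
     6 * uxx * uxxx * uxy * uyy * uyyy - 6 * uxx * uxxx * uxyy * uyy^2
     - 18 * uxx * uxxy * uxy * uxyy * uyy + 12 * uxx * uxxy * uxy^2 * uyyy
     - 6 * uxx^2 * uxxy * uyy * uyyy + 9 * uxx * uxxy^2 * uyy^2
     - 6 * uxx^2 * uxy * uxyy * uyyy + 9 * uxx^2 * uxyy^2 * uyy
     + uxx^3 * uyyy^2 - 6 * uxxx * uxxy * uxy * uyy^2
     + 12 * uxxx * uxy^2 * uxyy * uyy - 8 * uxxx * uxy^3 * uyyy
     + uxxx^2 * uyy^3"

definition \<E> :: "surface_jet set" where
  "\<E> = {J. \<exists>u. has_jet_coords 3 J u \<and>
     (u 2 0 * u 0 2 - (u 1 1)^2) *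
       F (u 2 0) (u 1 1) (u 0 2) (u 3 0) (u 2 1) (u 1 2) (u 0 3) = 0}"

end

theory Submission
  imports Defs
begin

text \<open>Up to sign, \<open>F\<close> is the resultant of the quadratic form \<open>h\<close> of second derivatives and the
  cubic form \<open>c\<close> of third derivatives of \<open>f\<close>. If an affine map carries the graph of \<open>f\<close> to that
  of \<open>g\<close>, differentiating the relation between \<open>f\<close> and \<open>g\<close> three times along lines of the
  \<open>(x, y)\<close>-plane shows that the forms \<open>h'\<close>, \<open>c'\<close> of \<open>g\<close>, pulled back along an invertible linear
  map of the plane, are \<open>l h\<close> and \<open>l c - 3 m h\<close> with a number \<open>l\<close> and a linear form \<open>m\<close>. The
  resultant does not see multiples of \<open>h\<close> added to \<open>c\<close>, so the discriminant of \<open>h\<close> and \<open>F\<close>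
  are relative invariants.\<close>

section \<open>Derivatives along curves\<close>

lemma DERIV_along_curve:
  assumes D: "open D" "f differentiable_on D" "(a t, b t) \<in> D"
    and a: "(a has_real_derivative a') (at t)" and b: "(b has_real_derivative b') (at t)"
  shows "((\<lambda>t. f (a t, b t)) has_real_derivative dx f (a t, b t) * a' + dy f (a t, b t) * b') (at t)"
proof -
  from D have "f differentiable (at (a t, b t))"
    by (simp add: differentiable_on_eq_differentiable_at)
  then obtain f' where f': "(f has_derivative f') (at (a t, b t))"
    by (auto simp: differentiable_def)
  interpret linear f' using f' by (rule has_derivative_linear)
  have lin: "f' (u, v) = f' (1, 0) * u + f' (0, 1) * v" for u v
  proof -
    have "f' (u, v) = f' (u *\<^sub>R (1, 0) + v *\<^sub>R (0, 1))" by simp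
    also have "\<dots> = f' (1, 0) * u + f' (0, 1) * v" unfolding add scale by simp
    finally show ?thesis .
  qed
  \<comment> \<open>Stated for arbitrary curves through the point so that it also covers the two
    coordinate lines; these identify \<open>f' (1, 0)\<close> and \<open>f' (0, 1)\<close> with
    \<open>dx f\<close> and \<open>dy f\<close>, which are defined by one-variable
    derivatives.\<close>
  have chain: "((\<lambda>t. f (c t, d t)) has_real_derivative f' (1, 0) * c' + f' (0, 1) * d') (at s)"
    if "(c has_real_derivative c') (at s)" "(d has_real_derivative d') (at s)" "(c s, d s) = (a t, b t)"
    for c d :: "real \<Rightarrow> real" and c' d' s
  proof -
    have "((\<lambda>t. (c t, d t)) has_derivative (\<lambda>h. (c' * h, d' * h))) (at s)"
      using that(1,2) unfolding has_field_derivative_def by (rule has_derivative_Pair)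
    from has_derivative_compose[OF this, of f f'] f' that(3)
    have "((\<lambda>t. f (c t, d t)) has_derivative (\<lambda>h. f' (c' * h, d' * h))) (at s)" by simp
    then show ?thesis
      unfolding has_field_derivative_def
      by (rule has_derivative_eq_rhs) (rule ext, subst lin, simp add: algebra_simps)
  qed
  have "dx f (a t, b t) = f' (1, 0)"
    using chain[OF DERIV_ident DERIV_const, of "a t" "b t"] by (simp add: dx_def DERIV_imp_deriv)
  moreover have "dy f (a t, b t) = f' (0, 1)"
    using chain[OF DERIV_const DERIV_ident, of "a t" "b t"] by (simp add: dy_def DERIV_imp_deriv)
  ultimately show ?thesis
    using chain[OF a b refl] by simp
qed

section \<open>Symmetry of the mixed second derivatives\<close>

lemma mvt_mixed:
  fixes k k1 k12 :: "real \<Rightarrow> real \<Rightarrow> real"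
  assumes h: "0 < h"
    and k1: "\<And>s t. s \<in> {a..a+h} \<Longrightarrow> t \<in> {b..b+h} \<Longrightarrow> ((\<lambda>s. k s t) has_real_derivative k1 s t) (at s)"
    and k12: "\<And>s t. s \<in> {a..a+h} \<Longrightarrow> t \<in> {b..b+h} \<Longrightarrow> ((\<lambda>t. k1 s t) has_real_derivative k12 s t) (at t)"
  obtains s t where "s \<in> {a..a+h}" "t \<in> {b..b+h}"
    "k (a+h) (b+h) - k (a+h) b - k a (b+h) + k a b = h * h * k12 s t"
proof -
  \<comment> \<open>The mean value theorem is used twice: in \<open>s\<close> for the difference of
    the slices \<open>t = b+h\<close> and \<open>t = b\<close>, then in \<open>t\<close> for
    \<open>k1 s\<close>.\<close>
  have "\<exists>s. a < s \<and> s < a+h \<and> (k (a+h) (b+h) - k (a+h) b) - (k a (b+h) - k a b)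
      = (a + h - a) * (k1 s (b+h) - k1 s b)"
    using h by (intro MVT2 derivative_intros k1) auto
  then obtain s where s: "a < s" "s < a+h"
    "(k (a+h) (b+h) - k (a+h) b) - (k a (b+h) - k a b) = h * (k1 s (b+h) - k1 s b)"
    by auto
  have "\<exists>t. b < t \<and> t < b+h \<and> k1 s (b+h) - k1 s b = (b + h - b) * k12 s t"
    using h s by (intro MVT2 k12) auto
  then obtain t where "b < t" "t < b+h" "k1 s (b+h) - k1 s b = h * k12 s t"
    by auto
  with s show thesis by (intro that[of s t]) auto
qed

text \<open>Schwarz's theorem by contradiction: a gap \<open>2 * e\<close> at \<open>z\<close>
  cannot persist once the two mixed derivatives, each within \<open>e\<close> of its value at
  \<open>z\<close>, take a common value.\<close>

lemma dx_dy_commute: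
  assumes D: "open D" "z \<in> D" and f: "Ck_on 2 D f"
  shows "dx (dy f) z = dy (dx f) z"
proof (rule ccontr)
  assume ne: "dx (dy f) z \<noteq> dy (dx f) z"
  define e where "e = dist (dx (dy f) z) (dy (dx f) z) / 2"
  have e: "e > 0" using ne by (simp add: e_def)
  obtain x y where z: "z = (x, y)" by (cases z)
  have df: "f differentiable_on D" "dx f differentiable_on D" "dy f differentiable_on D"
    and cont: "continuous_on D (dx (dy f))" "continuous_on D (dy (dx f))"
    using f by (auto simp: numeral_2_eq_2)
  obtain d0 where d0: "d0 > 0" "ball z d0 \<subseteq> D"
    using D open_contains_ball by blast
  obtain d1 where d1: "d1 > 0" "\<And>w. w \<in> D \<Longrightarrow> dist w z < d1 \<Longrightarrow> dist (dx (dy f) w) (dx (dy f) z) < e"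
    using cont(1) D(2) e unfolding continuous_on_iff by metis
  obtain d2 where d2: "d2 > 0" "\<And>w. w \<in> D \<Longrightarrow> dist w z < d2 \<Longrightarrow> dist (dy (dx f) w) (dy (dx f) z) < e"
    using cont(2) D(2) e unfolding continuous_on_iff by metis
  \<comment> \<open>Points of the square of side \<open>h\<close> at \<open>z\<close> are at
    distance at most \<open>2 * h\<close> from \<open>z\<close>, so a third of the least radius
    keeps the square inside all three balls.\<close>
  define h where "h = Min {d0, d1, d2} / 3"
  have h: "0 < h" "2 * h < d0" "2 * h < d1" "2 * h < d2"
    using d0 d1 d2 by (auto simp: h_def min_def)
  have box: "dist (s, t) z \<le> 2 * h" if "s \<in> {x..x+h}" "t \<in> {y..y+h}" for s t
  proof -
    have "dist (s, t) z \<le> \<bar>s - x\<bar> + \<bar>t - y\<bar>"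
      unfolding z dist_Pair_Pair dist_real_def
      using sqrt_sum_squares_le_sum_abs[of "\<bar>s - x\<bar>" "\<bar>t - y\<bar>"] by simp
    with that show ?thesis by auto
  qed
  have boxD: "(s, t) \<in> D" if "s \<in> {x..x+h}" "t \<in> {y..y+h}" for s t
    using box[OF that] h d0(2) by (auto simp: subset_iff dist_commute)
  have px: "((\<lambda>s. k (s, t)) has_real_derivative dx k (s, t)) (at s)"
    and py: "((\<lambda>t. k (s, t)) has_real_derivative dy k (s, t)) (at t)"
    if "s \<in> {x..x+h}" "t \<in> {y..y+h}" "k differentiable_on D" for k s t
    using DERIV_along_curve[OF D(1) that(3), of "\<lambda>s. s" s "\<lambda>_. t" 1 0]
      DERIV_along_curve[OF D(1) that(3), of "\<lambda>_. s" t "\<lambda>t. t" 0 1] boxD that by auto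
  \<comment> \<open>The second difference of \<open>f\<close> over the square is symmetric in the
    two variables; taking the mean values in either order expresses it through either mixed
    derivative, each at its own point of the square.\<close>
  obtain s t where st: "s \<in> {x..x+h}" "t \<in> {y..y+h}"
    "f (x+h, y+h) - f (x+h, y) - f (x, y+h) + f (x, y) = h * h * dy (dx f) (s, t)"
    by (rule mvt_mixed[of h x y "\<lambda>s t. f (s, t)" "\<lambda>s t. dx f (s, t)" "\<lambda>s t. dy (dx f) (s, t)"])
      (rule h px py df | assumption)+
  obtain t' s' where st': "t' \<in> {y..y+h}" "s' \<in> {x..x+h}"
    "f (x+h, y+h) - f (x, y+h) - f (x+h, y) + f (x, y) = h * h * dx (dy f) (s', t')"
    by (rule mvt_mixed[of h y x "\<lambda>t s. f (s, t)" "\<lambda>t s. dy f (s, t)" "\<lambda>t s. dx (dy f) (s, t)"])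
      (rule h px py df | assumption)+
  have "h * h * dy (dx f) (s, t) = h * h * dx (dy f) (s', t')"
    using st(3) st'(3) by linarith
  then have eq: "dy (dx f) (s, t) = dx (dy f) (s', t')" using h(1) by simp
  have "dist (dy (dx f) (s, t)) (dy (dx f) z) < e"
    using d2(2)[OF boxD[OF st(1,2)]] box[OF st(1,2)] h by simp
  moreover have "dist (dx (dy f) (s', t')) (dx (dy f) z) < e"
    using d1(2)[OF boxD[OF st'(2,1)]] box[OF st'(2,1)] h by simp
  ultimately show False
    using eq dist_triangle_less_add[of "dx (dy f) z" "dx (dy f) (s', t')" e "dy (dx f) z" e]
    by (simp add: e_def dist_commute)
qed

lemma Ck_on_mono: "Ck_on (Suc k) D f \<Longrightarrow> Ck_on k D f"
proof (induction k arbitrary: f)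
  case 0
  then show ?case by (simp add: differentiable_imp_continuous_on)
next
  case (Suc k)
  then show ?case by (metis Ck_on.simps(2))
qed

section \<open>Differentials up to order three along curves, and their behaviour under affine maps
  of graphs\<close>

definition grad :: "(real \<times> real \<Rightarrow> real) \<Rightarrow> real \<times> real \<Rightarrow> real \<Rightarrow> real \<Rightarrow> real" where
  "grad f z u v = dx f z * u + dy f z * v"

text \<open>The polarized second differential: the third derivative along a curve pairs the velocity
  with the acceleration.\<close>

definition hess :: "(real \<times> real \<Rightarrow> real) \<Rightarrow> real \<times> real \<Rightarrow> real \<Rightarrow> real \<Rightarrow> real \<Rightarrow> real \<Rightarrow> real" where
  "hess f z u v u' v' =
     partial 2 0 f z * u * u' + partial 1 1 f z * (u * v' + v * u') + partial 0 2 f z * v * v'"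

definition cubic :: "(real \<times> real \<Rightarrow> real) \<Rightarrow> real \<times> real \<Rightarrow> real \<Rightarrow> real \<Rightarrow> real" where
  "cubic f z u v = partial 3 0 f z * u ^ 3 + 3 * partial 2 1 f z * u\<^sup>2 * v
     + 3 * partial 1 2 f z * u * v\<^sup>2 + partial 0 3 f z * v ^ 3"

context
  fixes D and f :: "real \<times> real \<Rightarrow> real" and a b da db dda ddb :: "real \<Rightarrow> real" and ddda dddb t :: real
  assumes D: "open D" "(a t, b t) \<in> D"
    and a: "(a has_real_derivative da t) (at t)" and b: "(b has_real_derivative db t) (at t)"
begin

lemma DERIV_curve1:
  assumes "Ck_on 1 D f"
  shows "((\<lambda>t. f (a t, b t)) has_real_derivative grad f (a t, b t) (da t) (db t)) (at t)"
  using DERIV_along_curve[of D f a t b] D a b assms by (simp add: grad_def)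

lemma DERIV_curve2:
  assumes f: "Ck_on 2 D f"
    and da: "(da has_real_derivative dda t) (at t)" and db: "(db has_real_derivative ddb t) (at t)"
  shows "((\<lambda>t. grad f (a t, b t) (da t) (db t)) has_real_derivative
    hess f (a t, b t) (da t) (db t) (da t) (db t) + grad f (a t, b t) (dda t) (ddb t)) (at t)"
proof -
  have df: "dx f differentiable_on D" "dy f differentiable_on D"
    using f by (auto simp: numeral_2_eq_2)
  show ?thesis
    unfolding grad_def
    by ((rule derivative_eq_intros DERIV_along_curve[OF D(1) df(1) D(2) a b]
        DERIV_along_curve[OF D(1) df(2) D(2) a b] da db refl)+)
      (use dx_dy_commute[OF D f] in
        \<open>simp add: hess_def partial_def eval_nat_numeral algebra_simps\<close>)
qed

text \<open>Of the three mixed \<open>hess\<close> terms, two come from the velocity slots of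
  \<open>hess\<close> and one from differentiating \<open>grad\<close> at the acceleration.\<close>

lemma DERIV_curve3:
  assumes f: "Ck_on 3 D f"
    and da: "(da has_real_derivative dda t) (at t)" and db: "(db has_real_derivative ddb t) (at t)"
    and dda: "(dda has_real_derivative ddda) (at t)" and ddb: "(ddb has_real_derivative dddb) (at t)"
  shows "((\<lambda>t. hess f (a t, b t) (da t) (db t) (da t) (db t) + grad f (a t, b t) (dda t) (ddb t))
    has_real_derivative cubic f (a t, b t) (da t) (db t)
      + 3 * hess f (a t, b t) (da t) (db t) (dda t) (ddb t) + grad f (a t, b t) ddda dddb) (at t)"
proof -
  have f2: "Ck_on 2 D f" "Ck_on 2 D (dx f)" "Ck_on 2 D (dy f)"
    using f Ck_on_mono[of 2 D f] by (auto simp: eval_nat_numeral)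
  have df: "dx f differentiable_on D" "dy f differentiable_on D" "dx (dx f) differentiable_on D"
    "dx (dy f) differentiable_on D" "dy (dy f) differentiable_on D"
    using f by (auto simp: eval_nat_numeral)
  let ?p = "(a t, b t)"
  have c1: "dy (dx f) ?p = dx (dy f) ?p" and c2: "dy (dx (dx f)) ?p = dx (dy (dx f)) ?p"
    and c3: "dy (dx (dy f)) ?p = dx (dy (dy f)) ?p"
    using f2 by (simp_all add: dx_dy_commute[OF D])
  \<comment> \<open>The outer \<open>dx\<close> differentiates, so the inner derivatives must
    commute on a neighbourhood of the point along the x-line, not just at the point.\<close>
  have c4: "dx (dy (dx f)) ?p = dx (dx (dy f)) ?p"
  proof -
    obtain e where e: "e > 0" "ball ?p e \<subseteq> D"
      using D open_contains_ball by blast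
    have "\<forall>\<^sub>F x in nhds (a t). dist x (a t) < e"
      using e(1) by (auto simp: eventually_nhds_metric)
    then have "\<forall>\<^sub>F x in nhds (a t). dy (dx f) (x, b t) = dx (dy f) (x, b t)"
    proof eventually_elim
      case (elim x)
      then have "(x, b t) \<in> D"
        using e(2) by (auto simp: subset_iff dist_Pair_Pair dist_commute)
      then show ?case using dx_dy_commute[OF D(1) _ f2(1)] by simp
    qed
    then show ?thesis unfolding dx_def[of "dy (dx f)"] dx_def[of "dx (dy f)"]
      by (auto intro: deriv_cong_ev)
  qed
  note ch = DERIV_along_curve[OF D(1) _ D(2) a b]
  show ?thesis
    unfolding grad_def hess_def partial_def
    by (simp add: eval_nat_numeral,
        (rule derivative_eq_intros ch[OF df(1)] ch[OF df(2)] ch[OF df(3)] ch[OF df(4)] ch[OF df(5)]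
          da db dda ddb refl)+)
      (simp add: cubic_def partial_def eval_nat_numeral c1 c2 c3 c4 algebra_simps)
qed

end

text \<open>\<open>g (X, Y) = U\<close> is differentiated along the line through \<open>z\<close>
  with direction \<open>(u, v)\<close>. The vector \<open>(w1, w2)\<close> is the image direction in
  the plane, and \<open>l\<close> measures the image of the vertical axis against the tangent plane
  of the graph of \<open>g\<close>.\<close>

lemma graph_transform_forms:
  fixes f g X Y U :: "real \<times> real \<Rightarrow> real" and z Z :: "real \<times> real"
    and a1 a2 a3 a0 b1 b2 b3 b0 c1 c2 c3 c0 u v w1 w2 l :: real
  defines "X \<equiv> \<lambda>(x, y). a1 * x + a2 * y + a3 * f (x, y) + a0"
    and "Y \<equiv> \<lambda>(x, y). b1 * x + b2 * y + b3 * f (x, y) + b0"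
    and "U \<equiv> \<lambda>(x, y). c1 * x + c2 * y + c3 * f (x, y) + c0"
  assumes D: "open D" "Ck_on 3 D f" "z \<in> D" and E: "open E" "Ck_on 3 E g"
    and g: "\<And>z. z \<in> D \<Longrightarrow> (X z, Y z) \<in> E \<and> g (X z, Y z) = U z"
  defines "Z \<equiv> (X z, Y z)"
    and "w1 \<equiv> a1 * u + a2 * v + a3 * grad f z u v"
    and "w2 \<equiv> b1 * u + b2 * v + b3 * grad f z u v"
    and "l \<equiv> c3 - grad g Z a3 b3"
  shows "grad g Z w1 w2 = c1 * u + c2 * v + c3 * grad f z u v" (is ?t1)
    and "hess g Z w1 w2 w1 w2 = l * hess f z u v u v" (is ?t2)
    and "cubic g Z w1 w2 = l * cubic f z u v - 3 * hess g Z w1 w2 a3 b3 * hess f z u v u v" (is ?t3)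
proof -
  obtain x y where z: "z = (x, y)" by (cases z)
  define p where "p t = (x + t * u, y + t * v)" for t
  define T where "T = p -` D"
  have T: "open T" "0 \<in> T"
    using D by (auto simp: T_def p_def z intro!: open_vimage continuous_intros)
  have pT: "p t \<in> D" if "t \<in> T" for t using that by (simp add: T_def)
  define f0 where "f0 t = f (p t)" for t
  define f1 where "f1 t = grad f (p t) u v" for t
  define f2 where "f2 t = hess f (p t) u v u v" for t
  define f3 where "f3 t = cubic f (p t) u v" for t
  have Ck: "Ck_on 1 D f" "Ck_on 2 D f" "Ck_on 1 E g" "Ck_on 2 E g"
    using D E Ck_on_mono[of 2 D f] Ck_on_mono[of 1 D f]
      Ck_on_mono[of 2 E g] Ck_on_mono[of 1 E g] by (simp_all add: eval_nat_numeral)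
  have lin: "((\<lambda>t. x + t * u) has_real_derivative u) (at t)"
    "((\<lambda>t. y + t * v) has_real_derivative v) (at t)" for t
    by (auto intro!: derivative_eq_intros)
  have f0: "(f0 has_real_derivative f1 t) (at t)" if "t \<in> T" for t
    using DERIV_curve1[where a="\<lambda>t. x + t * u" and b="\<lambda>t. y + t * v" and
        da="\<lambda>_. u" and db="\<lambda>_. v",
      OF D(1) _ lin Ck(1)] pT[OF that]
    by (simp add: f0_def[abs_def] f1_def p_def)
  have f1: "(f1 has_real_derivative f2 t) (at t)" if "t \<in> T" for t
    using DERIV_curve2[where a="\<lambda>t. x + t * u" and b="\<lambda>t. y + t * v" and
        da="\<lambda>_. u" and db="\<lambda>_. v" and dda="\<lambda>_. 0" and ddb="\<lambda>_. 0",
      OF D(1) _ lin Ck(2) DERIV_const DERIV_const]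
      pT[OF that]
    by (simp add: f1_def[abs_def] f2_def p_def grad_def)
  have f2: "(f2 has_real_derivative f3 t) (at t)" if "t \<in> T" for t
    using DERIV_curve3[where a="\<lambda>t. x + t * u" and b="\<lambda>t. y + t * v" and
        da="\<lambda>_. u" and db="\<lambda>_. v" and dda="\<lambda>_. 0" and ddb="\<lambda>_. 0" and ddda=0 and dddb=0,
      OF D(1) _ lin D(2) DERIV_const DERIV_const DERIV_const DERIV_const]
      pT[OF that]
    by (simp add: f2_def[abs_def] f3_def p_def grad_def hess_def)
  define A0 where "A0 t = X (p t)" for t
  define B0 where "B0 t = Y (p t)" for t
  define C0 where "C0 t = U (p t)" for t
  define A1 where "A1 t = a1 * u + a2 * v + a3 * f1 t" for t
  define B1 where "B1 t = b1 * u + b2 * v + b3 * f1 t" for t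
  define C1 where "C1 t = c1 * u + c2 * v + c3 * f1 t" for t
  have A0: "(A0 has_real_derivative A1 t) (at t)" if "t \<in> T" for t
    unfolding A0_def[abs_def] A1_def X_def p_def
    by (auto intro!: derivative_eq_intros f0[OF that, unfolded f0_def[abs_def] p_def])
  have B0: "(B0 has_real_derivative B1 t) (at t)" if "t \<in> T" for t
    unfolding B0_def[abs_def] B1_def Y_def p_def
    by (auto intro!: derivative_eq_intros f0[OF that, unfolded f0_def[abs_def] p_def])
  have C0: "(C0 has_real_derivative C1 t) (at t)" if "t \<in> T" for t
    unfolding C0_def[abs_def] C1_def U_def p_def
    by (auto intro!: derivative_eq_intros f0[OF that, unfolded f0_def[abs_def] p_def])
  have A1: "(A1 has_real_derivative a3 * f2 t) (at t)"
    and B1: "(B1 has_real_derivative b3 * f2 t) (at t)"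
    and C1: "(C1 has_real_derivative c3 * f2 t) (at t)" if "t \<in> T" for t
    unfolding A1_def[abs_def] B1_def[abs_def] C1_def[abs_def]
    by (auto intro!: derivative_eq_intros f1[OF that])
  have A2: "((\<lambda>t. a3 * f2 t) has_real_derivative a3 * f3 t) (at t)"
    and B2: "((\<lambda>t. b3 * f2 t) has_real_derivative b3 * f3 t) (at t)"
    and C2: "((\<lambda>t. c3 * f2 t) has_real_derivative c3 * f3 t) (at t)"
    if "t \<in> T" for t
    by (auto intro!: derivative_eq_intros f2[OF that])
  have E': "(A0 t, B0 t) \<in> E" and eq0: "g (A0 t, B0 t) = C0 t" if "t \<in> T" for t
    using g[OF pT[OF that]] by (simp_all add: A0_def B0_def C0_def)
  \<comment> \<open>Functions that agree on the open set \<open>T\<close> of times have equal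
    derivatives there. The identities are therefore kept for every \<open>t\<close> in
    \<open>T\<close>, so that each can be differentiated into the next, and \<open>t = 0\<close> is
    inserted only at the end.\<close>
  have step: "k' = m'"
    if "(k has_real_derivative k') (at t)" "(m has_real_derivative m') (at t)"
      "t \<in> T" "\<And>t. t \<in> T \<Longrightarrow> k t = m t" for t k' m' and k m :: "real \<Rightarrow> real"
    using has_field_derivative_transform_within_open[OF that(1) T(1) that(3), of m] that(2,4)
    by (auto intro: DERIV_unique)
  have eq1: "grad g (A0 t, B0 t) (A1 t) (B1 t) = C1 t" if t: "t \<in> T" for t
    using DERIV_curve1[where a=A0 and b=B0 and da=A1 and db=B1,
      OF E(1) E'[OF t] A0[OF t] B0[OF t] Ck(3)] C0[OF t]
    by (rule step) (use t eq0 in auto)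
  have eq2: "hess g (A0 t, B0 t) (A1 t) (B1 t) (A1 t) (B1 t)
      + grad g (A0 t, B0 t) (a3 * f2 t) (b3 * f2 t) = c3 * f2 t" if t: "t \<in> T" for t
    using DERIV_curve2[where a=A0 and b=B0 and da=A1 and db=B1 and dda="\<lambda>t. a3 * f2 t" and ddb="\<lambda>t. b3 * f2 t",
      OF E(1) E'[OF t] A0[OF t] B0[OF t] Ck(4) A1[OF t] B1[OF t]] C1[OF t]
    by (rule step) (use t eq1 in auto)
  have eq3: "cubic g (A0 t, B0 t) (A1 t) (B1 t)
      + 3 * hess g (A0 t, B0 t) (A1 t) (B1 t) (a3 * f2 t) (b3 * f2 t)
      + grad g (A0 t, B0 t) (a3 * f3 t) (b3 * f3 t) = c3 * f3 t" if t: "t \<in> T" for t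
    using DERIV_curve3[where a=A0 and b=B0 and da=A1 and db=B1 and dda="\<lambda>t. a3 * f2 t" and ddb="\<lambda>t. b3 * f2 t",
      OF E(1) E'[OF t] A0[OF t] B0[OF t] E(2) A1[OF t] B1[OF t] A2[OF t] B2[OF t]]
      C2[OF t]
    by (rule step) (use t eq2 in auto)
  have p0: "p 0 = z" by (simp add: p_def z)
  have at0: "(A0 0, B0 0) = Z" "A1 0 = w1" "B1 0 = w2" "C1 0 = c1 * u + c2 * v + c3 * grad f z u v"
    "f2 0 = hess f z u v u v" "f3 0 = cubic f z u v"
    by (simp_all add: A0_def B0_def A1_def B1_def C1_def f1_def f2_def f3_def p0 Z_def w1_def w2_def)
  show ?t1
    using eq1[OF T(2)] unfolding at0 .
  \<comment> \<open>The plane curve has acceleration \<open>f2\<close> times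
    \<open>(a3, b3)\<close>; moving its \<open>grad g\<close> term to the right turns
    \<open>c3\<close> into \<open>l\<close>. The same happens to the \<open>f3\<close> terms in the
    third identity.\<close>
  show ?t2
    using eq2[OF T(2)] unfolding at0 by (simp add: l_def grad_def algebra_simps)
  show ?t3
    using eq3[OF T(2)] unfolding at0 by (simp add: l_def grad_def hess_def[of g _ _ _ a3]
        hess_def[of g _ _ _ "a3 * _"] algebra_simps)
qed

section \<open>Relative invariance of the resultant\<close>

definition jet_poly :: "(nat \<Rightarrow> nat \<Rightarrow> real) \<Rightarrow> real" where
  "jet_poly u = (u 2 0 * u 0 2 - (u 1 1)\<^sup>2) *
     F (u 2 0) (u 1 1) (u 0 2) (u 3 0) (u 2 1) (u 1 2) (u 0 3)"

text \<open>The entries are the coefficients of \<open>a x^2 + 2 b x y + c y^2\<close> after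
  \<open>x = p u + q v\<close>, \<open>y = r u + n v\<close>.\<close>

lemma disc_substitution:
  fixes a b c :: real
  shows "(a*p^2 + 2*b*p*r + c*r^2) * (a*q^2 + 2*b*q*n + c*n^2) - (a*p*q + b*(p*n + q*r) + c*r*n)^2
    = (p*n - q*r)^2 * (a*c - b^2)"
  by algebra

text \<open>The same substitution, also in the cubic with coefficients
  \<open>d, 3 e, 3 f, g\<close>. The exponent is the product of the degrees 2 and 3 of the two
  forms, as for every resultant.\<close>

lemma F_substitution:
  "F (a*p^2 + 2*b*p*r + c*r^2) (a*p*q + b*(p*n + q*r) + c*r*n) (a*q^2 + 2*b*q*n + c*n^2)
     (d*p^3 + 3*e*p^2*r + 3*f*p*r^2 + g*r^3)
     (d*p^2*q + e*(2*p*q*r + p^2*n) + f*(2*p*r*n + q*r^2) + g*r^2*n)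
     (d*p*q^2 + e*(2*p*q*n + q^2*r) + f*(2*q*r*n + p*n^2) + g*r*n^2)
     (d*q^3 + 3*e*q^2*n + 3*f*q*n^2 + g*n^3) = (p*n - q*r)^6 * F a b c d e f g"
  unfolding F_def by algebra

text \<open>The cubic entries belong to \<open>l\<close> times the cubic minus
  \<open>3 (m u + k v)\<close> times the quadratic form. The subtracted product vanishes at the
  roots of the quadratic form; \<open>F\<close> has degree 3 in the quadratic and 2 in the cubic
  coefficients, whence \<open>l^5\<close>.\<close>

lemma F_add_multiple:
  "F (l*a) (l*b) (l*c) (l*d - 3*m*a) (l*e - 2*m*b - k*a) (l*f - m*c - 2*k*b) (l*g - 3*k*c)
     = l^5 * F a b c d e f g"
  unfolding F_def by algebra

lemma quadratic_form_eqD: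
  fixes a b c :: real
  assumes "\<And>u v. a * u\<^sup>2 + 2 * b * u * v + c * v\<^sup>2 = a' * u\<^sup>2 + 2 * b' * u * v + c' * v\<^sup>2"
  shows "a = a'" "b = b'" "c = c'"
  using assms[of 1 0] assms[of 0 1] assms[of 1 1] by simp_all

lemma cubic_form_eqD:
  fixes a b c d :: real
  assumes "\<And>u v. a * u^3 + 3 * b * u\<^sup>2 * v + 3 * c * u * v\<^sup>2 + d * v^3
    = a' * u^3 + 3 * b' * u\<^sup>2 * v + 3 * c' * u * v\<^sup>2 + d' * v^3"
  shows "a = a'" "b = b'" "c = c'" "d = d'"
  using assms[of 1 0] assms[of 0 1] assms[of 1 1] assms[of 1 "-1"] by simp_all

lemma jet_poly_transform:
  assumes hess: "\<And>u v. hess g Z (p*u + q * v) (r*u + n * v) (p*u + q * v) (r*u + n * v)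
      = l * hess f z u v u v"
    and cubic: "\<And>u v. cubic g Z (p*u + q * v) (r*u + n * v)
      = l * cubic f z u v - 3 * (m*u + k * v) * hess f z u v u v"
    and det: "p*n - q*r \<noteq> 0"
    and f: "jet_poly (\<lambda>i j. partial i j f z) = 0"
  shows "jet_poly (\<lambda>i j. partial i j g Z) = 0"
proof -
  define a b c where abc: "a = partial 2 0 f z" "b = partial 1 1 f z" "c = partial 0 2 f z"
  define d e h i where dehi: "d = partial 3 0 f z" "e = partial 2 1 f z"
    "h = partial 1 2 f z" "i = partial 0 3 f z"
  define a' b' c' where abc': "a' = partial 2 0 g Z" "b' = partial 1 1 g Z" "c' = partial 0 2 g Z"
  define d' e' h' i' where dehi': "d' = partial 3 0 g Z" "e' = partial 2 1 g Z"
    "h' = partial 1 2 g Z" "i' = partial 0 3 g Z"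
  \<comment> \<open>Both hypotheses are identities of forms in \<open>u\<close> and
    \<open>v\<close>; comparing coefficients brings them into the shape of the substitution
    identities.\<close>
  have "(a'*p^2 + 2*b'*p*r + c'*r^2) * u^2 + 2 * (a'*p*q + b'*(p*n + q*r) + c'*r*n) * u * v
      + (a'*q^2 + 2*b'*q*n + c'*n^2) * v^2 = (l*a) * u^2 + 2 * (l*b) * u * v + (l*c) * v^2" for u v
    using hess[of u v] unfolding hess_def abc[symmetric] abc'[symmetric] by algebra
  note H = quadratic_form_eqD[OF this]
  have "(d'*p^3 + 3*e'*p^2*r + 3*h'*p*r^2 + i'*r^3) * u^3
      + 3 * (d'*p^2*q + e'*(2*p*q*r + p^2*n) + h'*(2*p*r*n + q*r^2) + i'*r^2*n) * u^2 * v
      + 3 * (d'*p*q^2 + e'*(2*p*q*n + q^2*r) + h'*(2*q*r*n + p*n^2) + i'*r*n^2) * u * v^2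
      + (d'*q^3 + 3*e'*q^2*n + 3*h'*q*n^2 + i'*n^3) * v^3
    = (l*d - 3*m*a) * u^3 + 3 * (l*e - 2*m*b - k*a) * u^2 * v
      + 3 * (l*h - m*c - 2*k*b) * u * v^2 + (l*i - 3*k*c) * v^3" for u v
    using cubic[of u v]
    unfolding cubic_def hess_def abc[symmetric] abc'[symmetric] dehi[symmetric] dehi'[symmetric]
    by algebra
  note C = cubic_form_eqD[OF this]
  have "(p*n - q*r)^6 * F a' b' c' d' e' h' i' = l^5 * F a b c d e h i"
    unfolding F_substitution[symmetric] H C F_add_multiple ..
  moreover have "(p*n - q*r)^2 * (a'*c' - b'^2) = l^2 * (a*c - b^2)"
    unfolding disc_substitution[symmetric] H by (simp add: algebra_simps power2_eq_square)
  moreover have "a*c - b^2 = 0 \<or> F a b c d e h i = 0"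
    using f by (simp add: jet_poly_def abc dehi)
  ultimately have "a'*c' - b'^2 = 0 \<or> F a' b' c' d' e' h' i' = 0"
    using det by auto
  then show ?thesis
    by (auto simp: jet_poly_def abc' dehi')
qed

lemma det2_zero_kernel:
  fixes p q r n :: real
  assumes "p*n - q*r = 0"
  obtains u v where "u \<noteq> 0 \<or> v \<noteq> 0" "p*u + q * v = 0" "r*u + n * v = 0"
proof -
  \<comment> \<open>A nonzero row of the matrix, turned by a right angle, is annihilated by both
    rows.\<close>
  consider "n \<noteq> 0 \<or> r \<noteq> 0" | "p \<noteq> 0 \<or> q \<noteq> 0" | "p = 0" "q = 0" "r = 0" "n = 0" by blast
  then show thesis
  proof cases
    case 1
    then show thesis using assms by (intro that[of n "-r"]) (auto simp: algebra_simps)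
  next
    case 2
    then show thesis using assms by (intro that[of q "-p"]) (auto simp: algebra_simps)
  next
    case 3
    then show thesis by (intro that[of 1 0]) auto
  qed
qed

section \<open>Affine images of graphs\<close>

text \<open>Written as a combination of axis vectors so that continuity follows from that of
  \<open>f\<close>.\<close>

definition graph_point :: "(real \<times> real \<Rightarrow> real) \<Rightarrow> real \<times> real \<Rightarrow> real^3" where
  "graph_point f z = fst z *\<^sub>R axis 1 1 + snd z *\<^sub>R axis 2 1 + f z *\<^sub>R axis 3 1"

lemma graph_point_nth [simp]:
  "graph_point f z $ 1 = fst z" "graph_point f z $ 2 = snd z" "graph_point f z $ 3 = f z"
  by (simp_all add: graph_point_def axis_def)

lemma graph_near_eq_graph_point: "graph_near S p f \<Longrightarrow> p = graph_point f (xy p)"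
  by (auto simp: graph_near_def vec_eq_iff forall_3)

lemma Ck_on_subset: "Ck_on k D f \<Longrightarrow> E \<subseteq> D \<Longrightarrow> Ck_on k E f"
  by (induction k arbitrary: f) (auto intro: continuous_on_subset differentiable_on_subset)

text \<open>The substitution handed to \<open>jet_poly_transform\<close> is the differential at
  \<open>xy p\<close> of the plane map that sends \<open>z\<close> to the projection of
  \<open>\<psi> (graph_point f z)\<close>.\<close>

lemma jet_poly_affine:
  assumes \<psi>: "\<psi> \<in> Aff3" and S: "graph_near S p f" and S': "graph_near (\<psi> ` S) (\<psi> p) g"
    and f: "jet_poly (\<lambda>i j. partial i j f (xy p)) = 0"
  shows "jet_poly (\<lambda>i j. partial i j g (xy (\<psi> p))) = 0"
proof -
  obtain A :: "real^3^3" and b where A: "invertible A" "\<psi> = (\<lambda>p. A *v p + b)"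
    using \<psi> by (auto simp: Aff3_def)
  have \<psi>_nth: "\<psi> q $ i = A $ i $ 1 * q $ 1 + A $ i $ 2 * q $ 2 + A $ i $ 3 * q $ 3 + b $ i" for q i
    by (simp add: A matrix_vector_mult_def sum_3)
  obtain D W where D: "open D" "xy p \<in> D" "smooth_on D f" "open W" "p \<in> W"
    and SW: "S \<inter> W = {q. xy q \<in> D \<and> q $ 3 = f (xy q)} \<inter> W"
    using S by (auto simp: graph_near_def)
  obtain E W' where E: "open E" "smooth_on E g" "open W'" "\<psi> p \<in> W'"
    and SW': "\<psi> ` S \<inter> W' = {q. xy q \<in> E \<and> q $ 3 = g (xy q)} \<inter> W'"
    using S' by (auto simp: graph_near_def)
  have p: "p = graph_point f (xy p)" using S by (rule graph_near_eq_graph_point)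
  have contf: "continuous_on D f" using D(3) by (auto simp: smooth_on_def dest: spec[of _ 0])
  have cont: "continuous_on D (graph_point f)"
    unfolding graph_point_def by (intro continuous_intros contf)
  have cont': "continuous_on D (\<lambda>z. \<psi> (graph_point f z))"
    unfolding A(2) by (intro continuous_intros cont
        linear_continuous_on_compose[OF cont matrix_vector_mul_linear])
  \<comment> \<open>Over \<open>N\<close> the graph points lie in \<open>W\<close> and their images
    in \<open>W'\<close>, so both local graph descriptions apply.\<close>
  define N where "N = (D \<inter> graph_point f -` W) \<inter> (D \<inter> (\<lambda>z. \<psi> (graph_point f z)) -` W')"
  have N: "open N" "xy p \<in> N"
    using continuous_open_preimage[OF cont D(1) D(4)] continuous_open_preimage[OF cont' D(1) E(3)]
      D E p by (auto simp: N_def)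
  have Ck: "Ck_on 3 N f" "Ck_on 3 E g"
    using D E Ck_on_subset[of 3 D f N] by (auto simp: smooth_on_def N_def)
  have graph: "xy (\<psi> (graph_point f z)) \<in> E \<and> g (xy (\<psi> (graph_point f z))) = \<psi> (graph_point f z) $ 3"
    if "z \<in> N" for z
  proof -
    have "graph_point f z \<in> S \<inter> W"
      unfolding SW using that by (simp add: N_def)
    moreover have "\<psi> (graph_point f z) \<in> W'"
      using that by (simp add: N_def)
    ultimately have "\<psi> (graph_point f z) \<in> \<psi> ` S \<inter> W'" by blast
    then show ?thesis unfolding SW' by simp
  qed
  let ?z = "xy p" and ?Z = "xy (\<psi> p)"
  let ?L = "\<lambda>i (x, y). A $ i $ 1 * x + A $ i $ 2 * y + A $ i $ 3 * f (x, y) + b $ i"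
  let ?w = "\<lambda>i u v. A $ i $ 1 * u + A $ i $ 2 * v + A $ i $ 3 * grad f ?z u v"
  let ?l = "A $ 3 $ 3 - grad g ?Z (A $ 1 $ 3) (A $ 2 $ 3)"
  have Z: "(?L 1 ?z, ?L 2 ?z) = ?Z"
    using arg_cong[OF p, of "\<lambda>q. q $ 3"] by (simp add: \<psi>_nth)
  note T = graph_transform_forms[where z = ?z and D = N and E = E and f = f and g = g
      and ?a1.0 = "A $ 1 $ 1" and ?a2.0 = "A $ 1 $ 2" and ?a3.0 = "A $ 1 $ 3" and ?a0.0 = "b $ 1"
      and ?b1.0 = "A $ 2 $ 1" and ?b2.0 = "A $ 2 $ 2" and ?b3.0 = "A $ 2 $ 3" and ?b0.0 = "b $ 2"
      and ?c1.0 = "A $ 3 $ 1" and ?c2.0 = "A $ 3 $ 2" and ?c3.0 = "A $ 3 $ 3" and ?c0.0 = "b $ 3",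
      OF N(1) Ck(1) N(2) E(1) Ck(2), unfolded Z]
  have graph': "(?L 1 z, ?L 2 z) \<in> E \<and> g (?L 1 z, ?L 2 z) = ?L 3 z" if "z \<in> N" for z
    using graph[OF that] by (cases z) (simp add: \<psi>_nth)
  have t1: "grad g ?Z (?w 1 u v) (?w 2 u v) = ?w 3 u v" for u v
    by (rule T(1)) (rule graph')
  have t2: "hess g ?Z (?w 1 u v) (?w 2 u v) (?w 1 u v) (?w 2 u v) = ?l * hess f ?z u v u v" for u v
    by (rule T(2)) (rule graph')
  have t3: "cubic g ?Z (?w 1 u v) (?w 2 u v) = ?l * cubic f ?z u v
      - 3 * hess g ?Z (?w 1 u v) (?w 2 u v) (A $ 1 $ 3) (A $ 2 $ 3) * hess f ?z u v u v" for u v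
    by (rule T(3)) (rule graph')
  define P Q where PQ: "P i = A $ i $ 1 + A $ i $ 3 * dx f ?z" "Q i = A $ i $ 2 + A $ i $ 3 * dy f ?z" for i
  have w: "?w i u v = P i * u + Q i * v" for i u v
    by (simp add: PQ grad_def algebra_simps)
  \<comment> \<open>Otherwise some nonzero \<open>(u, v)\<close> has plane image 0. By
    \<open>t1\<close> the third component of the image then vanishes too, so the invertible
    \<open>A\<close> kills the tangent vector \<open>(u, v, grad f ?z u v)\<close>.\<close>
  have "P 1 * Q 2 - Q 1 * P 2 \<noteq> 0"
  proof
    assume "P 1 * Q 2 - Q 1 * P 2 = 0"
    then obtain u v where uv: "u \<noteq> 0 \<or> v \<noteq> 0" "?w 1 u v = 0" "?w 2 u v = 0"
      unfolding w by (rule det2_zero_kernel)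
    have "?w 3 u v = 0"
      using t1[of u v] unfolding uv by (simp add: grad_def)
    define q :: "real^3" where "q = graph_point (\<lambda>_. grad f ?z u v) (u, v)"
    have "A *v q = 0"
      using uv(2,3) \<open>?w 3 u v = 0\<close>
      by (simp add: vec_eq_iff forall_3 matrix_vector_mult_def sum_3 q_def)
    moreover obtain B where "B ** A = mat 1"
      using A(1) by (auto simp: invertible_def)
    ultimately have "q = 0"
      by (metis matrix_vector_mul_assoc matrix_vector_mul_lid matrix_vector_mult_0_right)
    then have "q $ 1 = 0" "q $ 2 = 0" by simp_all
    then show False using uv(1) by (simp add: q_def)
  qed
  \<comment> \<open>Linearity of \<open>hess\<close> in the moving direction gives the linear form
    \<open>m u + k v\<close> required by \<open>jet_poly_transform\<close>.\<close>
  moreover have "hess g ?Z (P 1 * u + Q 1 * v) (P 2 * u + Q 2 * v) (A $ 1 $ 3) (A $ 2 $ 3) =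
      hess g ?Z (P 1) (P 2) (A $ 1 $ 3) (A $ 2 $ 3) * u
      + hess g ?Z (Q 1) (Q 2) (A $ 1 $ 3) (A $ 2 $ 3) * v" for u v
    by (simp add: hess_def algebra_simps)
  ultimately show ?thesis
    using jet_poly_transform[of g ?Z "P 1" "Q 1" "P 2" "Q 2" ?l f ?z
        "hess g ?Z (P 1) (P 2) (A $ 1 $ 3) (A $ 2 $ 3)" "hess g ?Z (Q 1) (Q 2) (A $ 1 $ 3) (A $ 2 $ 3)"]
      t2 t3 f unfolding w by simp
qed

section \<open>From graphs to jets: invariance of \<open>\<E>\<close>\<close>

lemma \<E>_eq: "\<E> = {J. \<exists>u. has_jet_coords 3 J u \<and> jet_poly u = 0}"
  by (simp add: \<E>_def jet_poly_def)

lemma contact_refl: "graph_near S p f \<Longrightarrow> contact l p S S"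
proof -
  assume "graph_near S p f"
  moreover have "id \<in> Aff3"
    unfolding Aff3_def
    by (rule CollectI, rule exI[of _ "mat 1"], rule exI[of _ 0])
      (auto simp: invertible_def intro: exI[of _ "mat 1"])
  ultimately show ?thesis unfolding contact_def by (intro bexI[of _ id]) auto
qed

text \<open>The contact of \<open>\<phi>(S)\<close> and \<open>T\<close> is witnessed in coordinates \<open>\<psi>\<close> unrelated to \<open>(x, y, u)\<close>, so
  the vanishing is carried into these coordinates along \<open>S\<close> and back along \<open>T\<close>.\<close>

lemma jet_poly_contact:
  assumes \<phi>: "\<phi> \<in> Aff3" and S: "graph_near S p f" and T: "graph_near T (\<phi> p) g"
    and ST: "contact 3 (\<phi> p) (\<phi> ` S) T"
    and f: "jet_poly (\<lambda>i j. partial i j f (xy p)) = 0"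
  shows "jet_poly (\<lambda>i j. partial i j g (xy (\<phi> p))) = 0"
proof -
  obtain \<psi> f' g' where \<psi>: "\<psi> \<in> Aff3"
    and f': "graph_near (\<psi> ` \<phi> ` S) (\<psi> (\<phi> p)) f'" and g': "graph_near (\<psi> ` T) (\<psi> (\<phi> p)) g'"
    and eq: "\<And>i j. i + j \<le> 3 \<Longrightarrow> partial i j f' (xy (\<psi> (\<phi> p))) = partial i j g' (xy (\<psi> (\<phi> p)))"
    using ST unfolding contact_def by blast
  obtain \<psi>' where \<psi>': "\<psi>' \<in> Aff3" "\<And>p. \<psi>' (\<psi> p) = p"
    using Aff3_inverse[OF \<psi>] by metis
  have "jet_poly (\<lambda>i j. partial i j f' (xy (\<psi> (\<phi> p)))) = 0"
    using jet_poly_affine[OF Aff3_comp[OF \<psi> \<phi>] S _ f, of f'] f' by (simp add: image_comp)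
  then have "jet_poly (\<lambda>i j. partial i j g' (xy (\<psi> (\<phi> p)))) = 0"
    by (simp add: jet_poly_def eq)
  then show ?thesis
    using jet_poly_affine[OF \<psi>'(1) g', of g] T by (simp add: \<psi>'(2) image_image)
qed

theorem proposition3p1:
  shows "aff_invariant 3 \<E>"
  unfolding aff_invariant_def
proof (intro conjI ballI impI)
  show "\<E> \<subseteq> jet_space 3"
    by (fastforce simp: \<E>_def has_jet_coords_def jet_space_def graph_near_def)
next
  fix \<phi> J
  assume \<phi>: "\<phi> \<in> Aff3" and J: "J \<in> \<E>" and chart: "jet_action \<phi> J \<in> graph_chart 3"
  obtain u S p f where S: "graph_near S p f" and JS: "J = jet 3 S p"
    and u: "\<And>i j. i + j \<le> 3 \<Longrightarrow> u i j = partial i j f (xy p)" and u0: "jet_poly u = 0"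
    using J by (auto simp: \<E>_eq has_jet_coords_def)
  have f: "jet_poly (\<lambda>i j. partial i j f (xy p)) = 0"
    using u0 by (simp add: jet_poly_def u)
  obtain T q g where T: "smooth_surface T" "graph_near T q g" "jet_action \<phi> J = jet 3 T q"
    using chart by (auto simp: graph_chart_def has_jet_coords_def)
  have jets: "jet 3 (\<phi> ` S) (\<phi> p) = jet 3 T q"
    using T(3) by (simp add: JS jet_action_jet[OF \<phi>])
  then have q: "q = \<phi> p" by (simp add: jet_def)
  have "T \<in> snd (jet 3 T q)"
    using T contact_refl by (simp add: jet_def)
  then have "contact 3 (\<phi> p) (\<phi> ` S) T"
    unfolding jets[symmetric] by (simp add: jet_def)
  then have "jet_poly (\<lambda>i j. partial i j g (xy q)) = 0"
    using jet_poly_contact[OF \<phi> S _ _ f] T(2) q by simp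
  moreover have "has_jet_coords 3 (jet_action \<phi> J) (\<lambda>i j. partial i j g (xy q))"
    unfolding has_jet_coords_def using T by blast
  ultimately show "jet_action \<phi> J \<in> \<E>"
    unfolding \<E>_eq by blast
qed

end
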